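(* Let $\mathcal A$ be a radical-dense variety. If $\mathcal A$ has a nontrivial injective algebra and contains a $test_d$-algebra, then every injective algebra in $\mathcal A$ is semisimple.
   Context: A residuated lattice is an algebra $\langle A,\wedge,\vee,\odot,\rightarrow,0,1\rangle$ of type $\langle2,2,2,2,0,0\rangle$ such that $\langle A,\odot,1\rangle$ is a commutative monoid, $\langle A,\vee,\wedge,0,1\rangle$ is a bounded lattice (order $\le$), and $a\odot b\le c$ iff $a\le b\rightarrow c$. Put $\neg x=x\rightarrow0$, $a^1=a$, $a^{n+1}=a^n\odot a$. An element $a$ is nilpotent if $a^n=0$ for some $n$; dense if $\neg a=0$; a unity if $\neg(a^n)$ is nilpotent for every $n\ge1$; idempotent if $a\odot a=a$. $Ds(A)$ is the set of dense elements, $Rad(A)$ the intersection of all maximal proper implicative filters (equivalently, the set of unities); $A$ is semisimple iff $Rad(A)=\{1\}$. A variety $\mathcal A$ is radical-dense if it is a subvariety of the variety of residuated lattices and $Rad(A)=Ds(A)$ for all $A\in\mathcal A$. An algebra $T\in\mathcal A$ is a $test_d$-algebra if there are $\epsilon,t\in Rad(T)$ with $\epsilon$ idempotent, $t<\epsilon$ and $\epsilon\rightarrow t\le\epsilon$. Homomorphisms preserve all operations including $0,1$. $A\in\mathcal A$ is injective in $\mathcal A$ if for every injective homomorphism $f:B\to C$ with $B,C\in\mathcal A$ and every homomorphism $g:B\to A$ there is a homomorphism $h:C\to A$ with $h\circ f=g$.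
   Formalization: In the definition of test_d-algebra, ε is additionally required to be different from 1; with ε = 1 allowed the claim fails, e.g. for the variety generated by the three-element Heyting chain, which is itself a non-semisimple injective. *)

theory Defs
  imports "HOL-Algebra.Group" "HOL-Library.Infinite_Typeclass"
begin

record 'a rl = "'a monoid" +
  rl_meet :: "'a \<Rightarrow> 'a \<Rightarrow> 'a"  (infixl "\<curlywedge>\<index>" 70)
  rl_join :: "'a \<Rightarrow> 'a \<Rightarrow> 'a"  (infixl "\<curlyvee>\<index>" 65)
  rl_imp  :: "'a \<Rightarrow> 'a \<Rightarrow> 'a"  (infixr "\<Rrightarrow>\<index>" 60)
  rl_zero :: 'a  ("\<zero>\<index>")

definition rl_le :: "('a, 'm) rl_scheme \<Rightarrow> 'a \<Rightarrow> 'a \<Rightarrow> bool"  (infix "\<preceq>\<index>" 50)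
  where "x \<preceq>\<^bsub>A\<^esub> y \<longleftrightarrow> x \<curlywedge>\<^bsub>A\<^esub> y = x"

locale residuated_lattice = comm_monoid A for A (structure) +
  assumes meet_closed: "\<lbrakk>x \<in> carrier A; y \<in> carrier A\<rbrakk> \<Longrightarrow> x \<curlywedge> y \<in> carrier A"
    and join_closed: "\<lbrakk>x \<in> carrier A; y \<in> carrier A\<rbrakk> \<Longrightarrow> x \<curlyvee> y \<in> carrier A"
    and imp_closed: "\<lbrakk>x \<in> carrier A; y \<in> carrier A\<rbrakk> \<Longrightarrow> x \<Rrightarrow> y \<in> carrier A"
    and zero_closed: "\<zero> \<in> carrier A"
    and meet_comm: "\<lbrakk>x \<in> carrier A; y \<in> carrier A\<rbrakk> \<Longrightarrow> x \<curlywedge> y = y \<curlywedge> x"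
    and join_comm: "\<lbrakk>x \<in> carrier A; y \<in> carrier A\<rbrakk> \<Longrightarrow> x \<curlyvee> y = y \<curlyvee> x"
    and meet_assoc: "\<lbrakk>x \<in> carrier A; y \<in> carrier A; z \<in> carrier A\<rbrakk>
      \<Longrightarrow> (x \<curlywedge> y) \<curlywedge> z = x \<curlywedge> (y \<curlywedge> z)"
    and join_assoc: "\<lbrakk>x \<in> carrier A; y \<in> carrier A; z \<in> carrier A\<rbrakk>
      \<Longrightarrow> (x \<curlyvee> y) \<curlyvee> z = x \<curlyvee> (y \<curlyvee> z)"
    and meet_absorb: "\<lbrakk>x \<in> carrier A; y \<in> carrier A\<rbrakk> \<Longrightarrow> x \<curlywedge> (x \<curlyvee> y) = x"
    and join_absorb: "\<lbrakk>x \<in> carrier A; y \<in> carrier A\<rbrakk> \<Longrightarrow> x \<curlyvee> (x \<curlywedge> y) = x"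
    and zero_least: "x \<in> carrier A \<Longrightarrow> \<zero> \<preceq> x"
    and one_greatest: "x \<in> carrier A \<Longrightarrow> x \<preceq> \<one>"
    and residuation: "\<lbrakk>x \<in> carrier A; y \<in> carrier A; z \<in> carrier A\<rbrakk>
      \<Longrightarrow> x \<otimes> y \<preceq> z \<longleftrightarrow> x \<preceq> (y \<Rrightarrow> z)"

definition rl_neg :: "('a, 'm) rl_scheme \<Rightarrow> 'a \<Rightarrow> 'a"
  where "rl_neg A x = (x \<Rrightarrow>\<^bsub>A\<^esub> \<zero>\<^bsub>A\<^esub>)"

definition idempotent :: "('a, 'm) rl_scheme \<Rightarrow> 'a \<Rightarrow> bool"
  where "idempotent A a \<longleftrightarrow> a \<otimes>\<^bsub>A\<^esub> a = a"

definition Ds :: "('a, 'm) rl_scheme \<Rightarrow> 'a set"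
  where "Ds A = {a \<in> carrier A. rl_neg A a = \<zero>\<^bsub>A\<^esub>}"

definition implicative_filter :: "('a, 'm) rl_scheme \<Rightarrow> 'a set \<Rightarrow> bool"
  where "implicative_filter A F \<longleftrightarrow> F \<subseteq> carrier A \<and> \<one>\<^bsub>A\<^esub> \<in> F \<and>
    (\<forall>x\<in>carrier A. \<forall>y\<in>carrier A. x \<in> F \<and> (x \<Rrightarrow>\<^bsub>A\<^esub> y) \<in> F \<longrightarrow> y \<in> F)"

definition maximal_filter :: "('a, 'm) rl_scheme \<Rightarrow> 'a set \<Rightarrow> bool"
  where "maximal_filter A F \<longleftrightarrow> implicative_filter A F \<and> F \<noteq> carrier A \<and>
    (\<forall>G. implicative_filter A G \<and> F \<subseteq> G \<and> G \<noteq> carrier A \<longrightarrow> G = F)"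

text \<open>The intersection is taken inside the carrier, so the trivial algebra, which has no proper
  implicative filter, is its own radical.\<close>

definition Rad :: "('a, 'm) rl_scheme \<Rightarrow> 'a set"
  where "Rad A = {a \<in> carrier A. \<forall>F. maximal_filter A F \<longrightarrow> a \<in> F}"

definition semisimple :: "('a, 'm) rl_scheme \<Rightarrow> bool"
  where "semisimple A \<longleftrightarrow> Rad A = {\<one>\<^bsub>A\<^esub>}"

definition nontrivial :: "('a, 'm) rl_scheme \<Rightarrow> bool"
  where "nontrivial A \<longleftrightarrow> (\<exists>x\<in>carrier A. \<exists>y\<in>carrier A. x \<noteq> y)"

definition rl_hom :: "('a, 'm) rl_scheme \<Rightarrow> ('b, 'n) rl_scheme \<Rightarrow> ('a \<Rightarrow> 'b) set"
  where "rl_hom A B = {h. h \<in> carrier A \<rightarrow> carrier B \<and>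
    (\<forall>x\<in>carrier A. \<forall>y\<in>carrier A.
      h (x \<curlywedge>\<^bsub>A\<^esub> y) = h x \<curlywedge>\<^bsub>B\<^esub> h y \<and>
      h (x \<curlyvee>\<^bsub>A\<^esub> y) = h x \<curlyvee>\<^bsub>B\<^esub> h y \<and>
      h (x \<otimes>\<^bsub>A\<^esub> y) = h x \<otimes>\<^bsub>B\<^esub> h y \<and>
      h (x \<Rrightarrow>\<^bsub>A\<^esub> y) = (h x \<Rrightarrow>\<^bsub>B\<^esub> h y)) \<and>
    h \<zero>\<^bsub>A\<^esub> = \<zero>\<^bsub>B\<^esub> \<and> h \<one>\<^bsub>A\<^esub> = \<one>\<^bsub>B\<^esub>}"

text \<open>
  Varieties are equational classes. A class of algebras is represented by its members whose
  carrier is a subset of a fixed but arbitrary infinite type \<open>'u\<close>, the universe. Since a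
  residuated lattice has only finitely many operations, all finitary, \<open>'u\<close> contains with
  any set the subalgebra it generates; and as residuated lattices have the congruence extension
  property, an algebra over \<open>'u\<close> is injective with respect to the members over \<open>'u\<close>
  iff it is injective with respect to members of arbitrary size.
\<close>

datatype rl_term =
    Var nat
  | Meet rl_term rl_term
  | Join rl_term rl_term
  | Mult rl_term rl_term
  | Imp rl_term rl_term
  | Zero
  | One

primrec rl_eval :: "('a, 'm) rl_scheme \<Rightarrow> (nat \<Rightarrow> 'a) \<Rightarrow> rl_term \<Rightarrow> 'a" where
  "rl_eval A v (Var i) = v i"
| "rl_eval A v (Meet s t) = rl_eval A v s \<curlywedge>\<^bsub>A\<^esub> rl_eval A v t"
| "rl_eval A v (Join s t) = rl_eval A v s \<curlyvee>\<^bsub>A\<^esub> rl_eval A v t"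
| "rl_eval A v (Mult s t) = rl_eval A v s \<otimes>\<^bsub>A\<^esub> rl_eval A v t"
| "rl_eval A v (Imp s t) = (rl_eval A v s \<Rrightarrow>\<^bsub>A\<^esub> rl_eval A v t)"
| "rl_eval A v Zero = \<zero>\<^bsub>A\<^esub>"
| "rl_eval A v One = \<one>\<^bsub>A\<^esub>"

definition satisfies :: "('a, 'm) rl_scheme \<Rightarrow> rl_term \<times> rl_term \<Rightarrow> bool"
  where "satisfies A e \<longleftrightarrow>
    (\<forall>v. range v \<subseteq> carrier A \<longrightarrow> rl_eval A v (fst e) = rl_eval A v (snd e))"

definition rl_variety :: "'u::infinite rl set \<Rightarrow> bool"
  where "rl_variety V \<longleftrightarrow>
    (\<exists>E. V = {A. residuated_lattice A \<and> (\<forall>e\<in>E. satisfies A e)})"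

definition radical_dense_variety :: "'u::infinite rl set \<Rightarrow> bool"
  where "radical_dense_variety V \<longleftrightarrow> rl_variety V \<and> (\<forall>A\<in>V. Rad A = Ds A)"

definition injective_in :: "'u::infinite rl set \<Rightarrow> 'u rl \<Rightarrow> bool"
  where "injective_in V A \<longleftrightarrow> A \<in> V \<and>
    (\<forall>B\<in>V. \<forall>C\<in>V. \<forall>f\<in>rl_hom B C. \<forall>g\<in>rl_hom B A. inj_on f (carrier B) \<longrightarrow>
      (\<exists>h\<in>rl_hom C A. \<forall>x\<in>carrier B. h (f x) = g x))"

text \<open>
  The element \<open>\<epsilon>\<close> is required to be different from \<open>\<one>\<close>: for
  \<open>\<epsilon> = \<one>\<close> the remaining conditions only say that the radical is not
  \<open>{\<one>}\<close>. They would then hold in the three-element Heyting chain, which is itself a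
  non-semisimple injective algebra of the radical-dense variety it generates.
\<close>

definition test_d_algebra :: "('a, 'm) rl_scheme \<Rightarrow> bool"
  where "test_d_algebra T \<longleftrightarrow>
    (\<exists>\<epsilon>\<in>Rad T. \<exists>t\<in>Rad T. idempotent T \<epsilon> \<and> \<epsilon> \<noteq> \<one>\<^bsub>T\<^esub> \<and>
      t \<preceq>\<^bsub>T\<^esub> \<epsilon> \<and> t \<noteq> \<epsilon> \<and> (\<epsilon> \<Rrightarrow>\<^bsub>T\<^esub> t) \<preceq>\<^bsub>T\<^esub> \<epsilon>)"

end

theory Submission
  imports Defs
begin

text \<open>
  Every injective \<open>A\<close> has a least dense element: the finite subsets \<open>i\<close> of \<open>Ds A\<close> have dense
  lower bounds \<open>d i\<close>, and in the reduced power of \<open>A\<close> along these finite subsets the class of \<open>d\<close>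
  is a dense element below all of \<open>Ds A\<close>; only the subalgebra generated by \<open>A\<close> and \<open>d\<close> is needed,
  which has a copy inside the universe, and a retraction onto \<open>A\<close> maps \<open>d\<close> to the least dense
  element \<open>m\<close>. Then \<open>m\<close> is idempotent, so \<open>\<epsilon> \<mapsto> m\<close> defines a homomorphism from the subalgebra
  \<open>{0, \<epsilon>, 1}\<close> of the test algebra to \<open>A\<close>. An extension \<open>h\<close> to the test algebra has
  \<open>h t = m\<close> by minimality, whence \<open>1 = m \<rightarrow> m = h (\<epsilon> \<rightarrow> t) \<le> h \<epsilon> = m\<close>, and \<open>1\<close> is the only
  dense element of \<open>A\<close>.
\<close>

section \<open>Order, residuation and dense elements\<close>

context residuated_lattice
begin

lemma le_antisym: "\<lbrakk>x \<in> carrier A; y \<in> carrier A; x \<preceq> y; y \<preceq> x\<rbrakk> \<Longrightarrow> x = y"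
  unfolding rl_le_def using meet_comm by metis

lemma le_trans: "\<lbrakk>x \<in> carrier A; y \<in> carrier A; z \<in> carrier A; x \<preceq> y; y \<preceq> z\<rbrakk> \<Longrightarrow> x \<preceq> z"
  unfolding rl_le_def using meet_assoc by metis

lemma meet_idem: "x \<in> carrier A \<Longrightarrow> x \<curlywedge> x = x"
  using meet_absorb[of x "x \<curlywedge> x"] join_absorb[of x x] by (simp add: meet_closed)

lemma join_idem: "x \<in> carrier A \<Longrightarrow> x \<curlyvee> x = x"
  using join_absorb[of x "x \<curlyvee> x"] meet_absorb[of x x] by (simp add: join_closed)

lemma le_refl: "x \<in> carrier A \<Longrightarrow> x \<preceq> x"
  by (simp add: rl_le_def meet_idem)

lemma one_le_iff: "x \<in> carrier A \<Longrightarrow> \<one> \<preceq> x \<longleftrightarrow> x = \<one>"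
  by (auto intro: le_antisym le_refl one_greatest)

lemma le_zero_iff: "x \<in> carrier A \<Longrightarrow> x \<preceq> \<zero> \<longleftrightarrow> x = \<zero>"
  by (auto intro: le_antisym le_refl zero_least zero_closed)

lemma imp_eq_one_iff: "\<lbrakk>x \<in> carrier A; y \<in> carrier A\<rbrakk> \<Longrightarrow> (x \<Rrightarrow> y) = \<one> \<longleftrightarrow> x \<preceq> y"
  using residuation[of \<one> x y] one_le_iff[of "x \<Rrightarrow> y"] by (simp add: imp_closed)

text \<open>By residuation the claim amounts to \<open>x \<preceq> (y \<Rrightarrow> y)\<close>,
  whose right side is the greatest element.\<close>

lemma mult_le_right: "\<lbrakk>x \<in> carrier A; y \<in> carrier A\<rbrakk> \<Longrightarrow> x \<otimes> y \<preceq> y"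
  using residuation[of x y y] imp_eq_one_iff[of y y] by (simp add: le_refl one_greatest)

lemma mult_le_left: "\<lbrakk>x \<in> carrier A; y \<in> carrier A\<rbrakk> \<Longrightarrow> x \<otimes> y \<preceq> x"
  using mult_le_right[of y x] by (simp add: m_comm)

lemma mult_zero: "x \<in> carrier A \<Longrightarrow> x \<otimes> \<zero> = \<zero>"
  using mult_le_right[of x \<zero>] by (simp add: le_zero_iff zero_closed)

lemma one_imp: "x \<in> carrier A \<Longrightarrow> (\<one> \<Rrightarrow> x) = x"
  using residuation[of x \<one> x] residuation[of "\<one> \<Rrightarrow> x" \<one> x]
  by (intro le_antisym) (auto simp: imp_closed le_refl)

lemma join_zero: "x \<in> carrier A \<Longrightarrow> x \<curlyvee> \<zero> = x"
  using join_absorb[of x \<zero>] zero_least[of x]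
  by (simp add: rl_le_def zero_closed meet_comm[of x \<zero>])

lemma join_one: "x \<in> carrier A \<Longrightarrow> x \<curlyvee> \<one> = \<one>"
  using join_absorb[of \<one> x] one_greatest[of x]
  by (simp add: rl_le_def join_comm[of x \<one>] meet_comm[of \<one> x])

lemma Ds_closed: "x \<in> Ds A \<Longrightarrow> x \<in> carrier A"
  and Ds_imp_zero: "x \<in> Ds A \<Longrightarrow> (x \<Rrightarrow> \<zero>) = \<zero>"
  by (simp_all add: Ds_def rl_neg_def)

lemma one_in_Ds: "\<one> \<in> Ds A"
  by (simp add: Ds_def rl_neg_def one_imp zero_closed)

text \<open>Residuating twice: if \<open>z \<otimes> x \<otimes> y\<close> is zero, density of
  \<open>y\<close> makes \<open>z \<otimes> x\<close> zero, and then density of \<open>x\<close>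
  makes \<open>z\<close> zero. Take \<open>z\<close> to be the negation of the product.\<close>

lemma mult_in_Ds:
  assumes "x \<in> Ds A" "y \<in> Ds A"
  shows "x \<otimes> y \<in> Ds A"
proof -
  have x: "x \<in> carrier A" "(x \<Rrightarrow> \<zero>) = \<zero>" and y: "y \<in> carrier A" "(y \<Rrightarrow> \<zero>) = \<zero>"
    using assms by (simp_all add: Ds_closed Ds_imp_zero)
  define z where "z = (x \<otimes> y \<Rrightarrow> \<zero>)"
  have z: "z \<in> carrier A"
    using x y by (simp add: z_def imp_closed zero_closed)
  have "z \<otimes> (x \<otimes> y) \<preceq> \<zero>"
    using z x y residuation[of z "x \<otimes> y" \<zero>] le_refl[of z] by (simp add: z_def[symmetric] zero_closed)
  then have "(z \<otimes> x) \<otimes> y \<preceq> \<zero>"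
    using z x y by (simp add: m_assoc)
  then have "z \<otimes> x \<preceq> \<zero>"
    using z x y residuation[of "z \<otimes> x" y \<zero>] by (simp add: zero_closed)
  then have "z \<preceq> \<zero>"
    using z x residuation[of z x \<zero>] by (simp add: zero_closed)
  then have "z = \<zero>"
    using z by (simp add: le_zero_iff)
  then show ?thesis
    using x y by (simp add: Ds_def rl_neg_def z_def)
qed

text \<open>A product lies below each of its factors, and products of dense elements are dense; the
  empty set is bounded by \<open>\<one>\<close>.\<close>

lemma finite_dense_lower_bound:
  assumes "finite S" "S \<subseteq> Ds A"
  shows "\<exists>y\<in>Ds A. \<forall>x\<in>S. y \<preceq> x"
  using assms
proof (induction S)
  case empty
  then show ?case using one_in_Ds by blast
next
  case (insert a S)
  then obtain y where y: "y \<in> Ds A" "\<forall>x\<in>S. y \<preceq> x" by auto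
  have a: "a \<in> carrier A" and yc: "y \<in> carrier A"
    using insert.prems y(1) by (simp_all add: Ds_closed)
  have "a \<otimes> y \<preceq> x" if "x \<in> S" for x
  proof (rule le_trans)
    show "y \<preceq> x" "x \<in> carrier A"
      using y(2) insert.prems that by (auto intro: Ds_closed)
    show "a \<otimes> y \<preceq> y"
      using a yc by (rule mult_le_right)
  qed (use a yc in simp_all)
  then have "\<forall>x\<in>insert a S. a \<otimes> y \<preceq> x"
    using mult_le_left[OF a yc] by simp
  then show ?case using insert.prems y(1) by (intro bexI[of _ "a \<otimes> y"] mult_in_Ds) auto
qed

text \<open>All axioms are quantified over the carrier, and the order is read off from the meet,
  which stays the same; so only closure has to be supplied.\<close>

lemma subalgebra:
  assumes S: "S \<subseteq> carrier A" "\<zero> \<in> S" "\<one> \<in> S"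
    and closed: "\<And>x y. \<lbrakk>x \<in> S; y \<in> S\<rbrakk>
      \<Longrightarrow> x \<curlywedge> y \<in> S \<and> x \<curlyvee> y \<in> S \<and> x \<otimes> y \<in> S \<and> (x \<Rrightarrow> y) \<in> S"
  shows "residuated_lattice (A\<lparr>carrier := S\<rparr>)"
proof -
  have S': "x \<in> carrier A" if "x \<in> S" for x using that S by blast
  show ?thesis
    by unfold_locales
      (auto simp: rl_le_def S' S closed meet_absorb join_absorb meet_assoc join_assoc m_assoc
        zero_least[unfolded rl_le_def] one_greatest[unfolded rl_le_def] residuation[unfolded rl_le_def]
        intro: meet_comm join_comm m_comm)
qed

end

section \<open>Homomorphisms, subalgebras and injectivity\<close>

lemma rl_homD:
  assumes "h \<in> rl_hom A B"
  shows "x \<in> carrier A \<Longrightarrow> h x \<in> carrier B"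
    and "\<lbrakk>x \<in> carrier A; y \<in> carrier A\<rbrakk> \<Longrightarrow> h (x \<curlywedge>\<^bsub>A\<^esub> y) = h x \<curlywedge>\<^bsub>B\<^esub> h y"
    and "\<lbrakk>x \<in> carrier A; y \<in> carrier A\<rbrakk> \<Longrightarrow> h (x \<Rrightarrow>\<^bsub>A\<^esub> y) = (h x \<Rrightarrow>\<^bsub>B\<^esub> h y)"
    and "h \<zero>\<^bsub>A\<^esub> = \<zero>\<^bsub>B\<^esub>"
  using assms unfolding rl_hom_def by auto

lemma rl_hom_le:
  assumes "h \<in> rl_hom A B" "x \<in> carrier A" "y \<in> carrier A" "x \<preceq>\<^bsub>A\<^esub> y"
  shows "h x \<preceq>\<^bsub>B\<^esub> h y"
  using assms rl_homD(2)[OF assms(1-3)] by (simp add: rl_le_def)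

text \<open>Density is the equation \<open>(x \<Rrightarrow> \<zero>) = \<zero>\<close>, and
  homomorphisms preserve equations.\<close>

lemma rl_hom_Ds:
  assumes "residuated_lattice A" "h \<in> rl_hom A B" "x \<in> Ds A"
  shows "h x \<in> Ds B"
proof -
  interpret residuated_lattice A by fact
  have x: "x \<in> carrier A" "(x \<Rrightarrow>\<^bsub>A\<^esub> \<zero>\<^bsub>A\<^esub>) = \<zero>\<^bsub>A\<^esub>"
    using assms(3) by (simp_all add: Ds_closed Ds_imp_zero)
  show ?thesis
    using rl_homD(1,4)[OF assms(2)] rl_homD(3)[OF assms(2) x(1) zero_closed] x
    by (simp add: Ds_def rl_neg_def)
qed

lemma rl_eval_carrier_update: "rl_eval (A\<lparr>carrier := S\<rparr>) v t = rl_eval A v t"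
  by (induction t) auto

lemma satisfies_subalgebra:
  "satisfies A e \<Longrightarrow> S \<subseteq> carrier A \<Longrightarrow> satisfies (A\<lparr>carrier := S\<rparr>) e"
  by (auto simp: satisfies_def rl_eval_carrier_update)


lemma injective_extend:
  assumes "injective_in V A" "B \<in> V" "C \<in> V" "f \<in> rl_hom B C" "g \<in> rl_hom B A"
    "inj_on f (carrier B)"
  obtains h where "h \<in> rl_hom C A" "\<And>x. x \<in> carrier B \<Longrightarrow> h (f x) = g x"
  using assms unfolding injective_in_def by blast


subsection \<open>Polynomials in one variable and reduced powers\<close>

datatype rl_op = OMeet | OJoin | OMult | OImp

primrec op_apply :: "('a, 'm) rl_scheme \<Rightarrow> rl_op \<Rightarrow> 'a \<Rightarrow> 'a \<Rightarrow> 'a" where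
  "op_apply A OMeet = rl_meet A"
| "op_apply A OJoin = rl_join A"
| "op_apply A OMult = mult A"
| "op_apply A OImp = rl_imp A"

datatype 'a rl_poly = Cst 'a | X | App rl_op "'a rl_poly" "'a rl_poly"

text \<open>Constants outside the carrier are junk and evaluate to \<open>1\<close>.\<close>

primrec poly_eval :: "('a, 'm) rl_scheme \<Rightarrow> 'a \<Rightarrow> 'a rl_poly \<Rightarrow> 'a" where
  "poly_eval A x (Cst a) = (if a \<in> carrier A then a else \<one>\<^bsub>A\<^esub>)"
| "poly_eval A x X = x"
| "poly_eval A x (App f s t) = op_apply A f (poly_eval A x s) (poly_eval A x t)"

lemma (in residuated_lattice) poly_eval_closed:
  assumes "x \<in> carrier A"
  shows "poly_eval A x p \<in> carrier A"
proof (induction p)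
  case (App f s t)
  then show ?case
    by (cases f) (auto simp: meet_closed join_closed imp_closed)
qed (use assms in auto)

text \<open>Polynomials over an infinite type are no more numerous than its elements. This lets the
  extension of \<open>A\<close> built below live inside the universe.\<close>

lemma ex_inj_rl_poly: "\<exists>f :: 'u::infinite rl_poly \<Rightarrow> 'u. inj f"
proof -
  \<comment> \<open>An infinite set is equipotent to its square, which gives a pairing function on
    \<open>'u\<close>.\<close>
  obtain p :: "'u \<times> 'u \<Rightarrow> 'u" where p: "inj p"
    using card_of_Times_same_infinite[OF infinite_UNIV] ordIso_iff_ordLeq
      card_of_ordLeq[of "UNIV \<times> UNIV :: ('u \<times> 'u) set" "UNIV :: 'u set"]
    by (metis UNIV_Times_UNIV)
  obtain \<tau> :: "nat \<Rightarrow> 'u" where \<tau>: "inj \<tau>"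
    using infinite_countable_subset[OF infinite_UNIV] by blast
  \<comment> \<open>The tags 0 and 1 mark constants and the variable, so the four operations start
    at 2.\<close>
  define tag :: "rl_op \<Rightarrow> nat" where "tag = case_rl_op 2 3 4 5"
  have tag: "tag f = tag g \<longleftrightarrow> f = g" "tag f \<noteq> 0" "tag f \<noteq> Suc 0" for f g
    by (cases f; cases g; simp add: tag_def)+
  define enc :: "'u rl_poly \<Rightarrow> 'u" where
    "enc = rec_rl_poly (\<lambda>a. p (\<tau> 0, a)) (p (\<tau> 1, \<tau> 0)) (\<lambda>f _ _ x y. p (\<tau> (tag f), p (x, y)))"
  have enc: "enc (Cst a) = p (\<tau> 0, a)" "enc X = p (\<tau> 1, \<tau> 0)"
    "enc (App f s t) = p (\<tau> (tag f), p (enc s, enc t))" for a f s t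
    by (simp_all add: enc_def)
  have "s = t" if "enc s = enc t" for s t
    using that
  proof (induction s arbitrary: t)
    case (Cst a)
    then show ?case by (cases t) (auto simp: enc inj_eq[OF p] inj_eq[OF \<tau>] tag tag(2,3)[symmetric])
  next
    case X
    then show ?case by (cases t) (auto simp: enc inj_eq[OF p] inj_eq[OF \<tau>] tag tag(2,3)[symmetric])
  next
    case (App f s1 s2)
    then show ?case by (cases t) (auto simp: enc inj_eq[OF p] inj_eq[OF \<tau>] tag tag(2,3)[symmetric])
  qed
  then show ?thesis by (meson injI)
qed

text \<open>The algebra \<open>C\<close> below is a copy inside the universe of the subalgebra of the reduced power of
  \<open>A\<close> modulo the filter \<open>F\<close> that is generated by the constants and the class of \<open>d\<close>.\<close>

lemma reduced_power_extension:
  fixes A :: "'u::infinite rl" (structure) and F :: "'i filter"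
  assumes "residuated_lattice A" and d: "\<And>i. d i \<in> carrier A"
  obtains C :: "'u rl" and r where
    "residuated_lattice C" "\<And>e. satisfies A e \<Longrightarrow> satisfies C e" "carrier C = range r"
    "\<And>s t. r s = r t \<longleftrightarrow> (\<forall>\<^sub>F i in F. poly_eval A (d i) s = poly_eval A (d i) t)"
    "\<And>f s t. op_apply C f (r s) (r t) = r (App f s t)"
    "\<zero>\<^bsub>C\<^esub> = r (Cst \<zero>\<^bsub>A\<^esub>)" "\<one>\<^bsub>C\<^esub> = r (Cst \<one>\<^bsub>A\<^esub>)"
proof -
  interpret residuated_lattice A by fact
  obtain enc :: "'u rl_poly \<Rightarrow> 'u" where enc: "inj enc"
    using ex_inj_rl_poly by blast
  define ev where "ev = (\<lambda>i. poly_eval A (d i))"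
  define eqv where "eqv = (\<lambda>s t. \<forall>\<^sub>F i in F. ev i s = ev i t)"
  have eqv_refl: "eqv s s" for s
    by (simp add: eqv_def)
  have eqv_sym: "eqv s t \<Longrightarrow> eqv t s" for s t
    by (simp add: eqv_def eq_commute)
  have eqv_trans: "eqv s t \<Longrightarrow> eqv t u \<Longrightarrow> eqv s u" for s t u
    unfolding eqv_def by (erule (1) eventually_elim2) simp
  \<comment> \<open>\<open>r\<close> plays the role of the quotient map: a class is represented by
    the code of one chosen member.\<close>
  define r where "r = (\<lambda>s. enc (SOME t. eqv s t))"
  have some: "eqv s (SOME t. eqv s t)" for s
    by (rule someI) (rule eqv_refl)
  have r: "r s = r t \<longleftrightarrow> eqv s t" for s t
  proof
    assume "r s = r t"
    then have "(SOME u. eqv s u) = (SOME u. eqv t u)"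
      by (simp add: r_def inj_eq[OF enc])
    then show "eqv s t"
      using some[of s] some[of t] eqv_sym eqv_trans by metis
  next
    assume "eqv s t"
    \<comment> \<open>Equivalent polynomials give the same predicate, so \<open>SOME\<close> picks
      the same member for both.\<close>
    then have "eqv s = eqv t"
      using eqv_sym eqv_trans by blast
    then show "r s = r t" by (simp add: r_def)
  qed
  \<comment> \<open>The preimages under \<open>r\<close> are arbitrary, but any two are equivalent,
    and equivalence is a congruence because it is defined pointwise.\<close>
  define opC where "opC = (\<lambda>f x y. r (App f (inv_into UNIV r x) (inv_into UNIV r y)))"
  define C :: "'u rl" where "C = \<lparr>carrier = range r, mult = opC OMult, one = r (Cst \<one>),
    rl_meet = opC OMeet, rl_join = opC OJoin, rl_imp = opC OImp, rl_zero = r (Cst \<zero>)\<rparr>"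
  have inv_r: "eqv (inv_into UNIV r (r s)) s" for s
    using r f_inv_into_f[of "r s" r UNIV] by blast
  have opC: "opC f (r s) (r t) = r (App f s t)" for f s t
    unfolding opC_def r eqv_def
    using inv_r[of s, unfolded eqv_def] inv_r[of t, unfolded eqv_def]
    by eventually_elim (simp add: ev_def)
  have C: "carrier C = range r" "\<zero>\<^bsub>C\<^esub> = r (Cst \<zero>)" "\<one>\<^bsub>C\<^esub> = r (Cst \<one>)"
    "r s \<otimes>\<^bsub>C\<^esub> r t = r (App OMult s t)" "r s \<curlywedge>\<^bsub>C\<^esub> r t = r (App OMeet s t)"
    "r s \<curlyvee>\<^bsub>C\<^esub> r t = r (App OJoin s t)" "(r s \<Rrightarrow>\<^bsub>C\<^esub> r t) = r (App OImp s t)" for s t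
    by (simp_all add: C_def opC)
  have ev_simps: "ev i (App f s t) = op_apply A f (ev i s) (ev i t)"
    "a \<in> carrier A \<Longrightarrow> ev i (Cst a) = a" for i f s t a
    by (simp_all add: ev_def)
  have ev: "ev i s \<in> carrier A" for i s
    unfolding ev_def using d by (rule poly_eval_closed)
  note base = C rl_le_def r eqv_def ev_simps ev zero_closed meet_closed join_closed imp_closed
    meet_absorb join_absorb meet_assoc join_assoc m_assoc
    zero_least[unfolded rl_le_def] one_greatest[unfolded rl_le_def] residuation[unfolded rl_le_def]
  \<comment> \<open>Each axiom holds at every index, hence eventually. Residuation transfers as
    well: its two sides are equivalent at each index, so one holds eventually iff the other
    does.\<close>
  have lattice: "residuated_lattice C"
    by unfold_locales
      (auto simp: base intro!: rangeI always_eventually meet_comm join_comm m_comm)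
  \<comment> \<open>A term applied to classes of polynomials is the class of a polynomial whose
    value at each index is the term applied to the values there. Identities of \<open>A\<close> can
    thus be checked index by index.\<close>
  have eval: "\<exists>s. rl_eval C (\<lambda>n. r (w n)) t = r s \<and> (\<forall>i. ev i s = rl_eval A (\<lambda>n. ev i (w n)) t)"
    for w t
  proof (induction t)
    case (Meet t1 t2)
    then obtain s1 s2 where "rl_eval C (\<lambda>n. r (w n)) t1 = r s1" "rl_eval C (\<lambda>n. r (w n)) t2 = r s2"
      "\<And>i. ev i s1 = rl_eval A (\<lambda>n. ev i (w n)) t1" "\<And>i. ev i s2 = rl_eval A (\<lambda>n. ev i (w n)) t2"
      by blast
    then show ?case by (intro exI[of _ "App OMeet s1 s2"]) (simp add: C ev_simps)
  next
    case (Join t1 t2)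
    then obtain s1 s2 where "rl_eval C (\<lambda>n. r (w n)) t1 = r s1" "rl_eval C (\<lambda>n. r (w n)) t2 = r s2"
      "\<And>i. ev i s1 = rl_eval A (\<lambda>n. ev i (w n)) t1" "\<And>i. ev i s2 = rl_eval A (\<lambda>n. ev i (w n)) t2"
      by blast
    then show ?case by (intro exI[of _ "App OJoin s1 s2"]) (simp add: C ev_simps)
  next
    case (Mult t1 t2)
    then obtain s1 s2 where "rl_eval C (\<lambda>n. r (w n)) t1 = r s1" "rl_eval C (\<lambda>n. r (w n)) t2 = r s2"
      "\<And>i. ev i s1 = rl_eval A (\<lambda>n. ev i (w n)) t1" "\<And>i. ev i s2 = rl_eval A (\<lambda>n. ev i (w n)) t2"
      by blast
    then show ?case by (intro exI[of _ "App OMult s1 s2"]) (simp add: C ev_simps)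
  next
    case (Imp t1 t2)
    then obtain s1 s2 where "rl_eval C (\<lambda>n. r (w n)) t1 = r s1" "rl_eval C (\<lambda>n. r (w n)) t2 = r s2"
      "\<And>i. ev i s1 = rl_eval A (\<lambda>n. ev i (w n)) t1" "\<And>i. ev i s2 = rl_eval A (\<lambda>n. ev i (w n)) t2"
      by blast
    then show ?case by (intro exI[of _ "App OImp s1 s2"]) (simp add: C ev_simps)
  next
    case Zero
    then show ?case using C(2) ev_simps(2) zero_closed by auto
  next
    case One
    then show ?case using C(3) ev_simps(2) one_closed by auto
  qed auto
  have sat: "satisfies C e" if e: "satisfies A e" for e
    unfolding satisfies_def
  proof (intro allI impI)
    fix v :: "nat \<Rightarrow> 'u" assume "range v \<subseteq> carrier C"
    then have "r (inv_into UNIV r (v n)) = v n" for n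
      by (intro f_inv_into_f) (auto simp: C)
    \<comment> \<open>A valuation in \<open>C\<close> is lifted to polynomials, which turns it into
      one valuation in \<open>A\<close> for each index.\<close>
    moreover define w where "w = (\<lambda>n. inv_into UNIV r (v n))"
    ultimately have w: "v = (\<lambda>n. r (w n))"
      by (simp add: fun_eq_iff)
    obtain s where s: "rl_eval C v (fst e) = r s" "\<And>i. ev i s = rl_eval A (\<lambda>n. ev i (w n)) (fst e)"
      using eval[of w "fst e"] unfolding w by blast
    obtain t where t: "rl_eval C v (snd e) = r t" "\<And>i. ev i t = rl_eval A (\<lambda>n. ev i (w n)) (snd e)"
      using eval[of w "snd e"] unfolding w by blast
    have "ev i s = ev i t" for i
      using e[unfolded satisfies_def, rule_format, of "\<lambda>n. ev i (w n)"] ev by (auto simp: s(2) t(2))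
    then show "rl_eval C v (fst e) = rl_eval C v (snd e)"
      by (simp add: s t r eqv_def)
  qed
  have op: "op_apply C f (r s) (r t) = r (App f s t)" for f s t
    by (cases f) (simp_all add: C)
  show ?thesis
    by (rule that[OF lattice sat C(1) r[unfolded eqv_def ev_def] op C(2,3)])
qed

section \<open>The least dense element of an injective algebra\<close>

lemma injective_least_dense:
  fixes A :: "'u::infinite rl" (structure)
  assumes V: "rl_variety V" and inj: "injective_in V A"
  shows "\<exists>m\<in>Ds A. \<forall>x\<in>Ds A. m \<preceq>\<^bsub>A\<^esub> x"
proof -
  obtain E where E: "V = {A. residuated_lattice A \<and> (\<forall>e\<in>E. satisfies A e)}"
    using V by (auto simp: rl_variety_def)
  have AV: "A \<in> V" using inj by (simp add: injective_in_def)
  interpret residuated_lattice A using AV E by simp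
  define F where "F = finite_subsets_at_top (Ds A)"
  have F: "F \<noteq> bot" by (simp add: F_def)
  obtain d0 where d0: "\<And>i. finite i \<and> i \<subseteq> Ds A \<Longrightarrow> d0 i \<in> Ds A \<and> (\<forall>x\<in>i. d0 i \<preceq> x)"
    using finite_dense_lower_bound by metis
  \<comment> \<open>The default \<open>\<one>\<close> keeps \<open>d i\<close> dense at every index,
    including sets that are infinite or not contained in \<open>Ds A\<close>.\<close>
  define d where "d = (\<lambda>i. if finite i \<and> i \<subseteq> Ds A then d0 i else \<one>)"
  have d: "d i \<in> Ds A" for i
    using d0 one_in_Ds by (simp add: d_def)
  \<comment> \<open>The bound holds at every finite subset of \<open>Ds A\<close> that contains
    \<open>x\<close>.\<close>
  have below: "\<forall>\<^sub>F i in F. d i \<preceq> x" if "x \<in> Ds A" for x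
    unfolding F_def eventually_finite_subsets_at_top
    by (rule exI[of _ "{x}"]) (use that d0 in \<open>auto simp: d_def\<close>)
  obtain C :: "'u rl" and r where C: "residuated_lattice C"
    "\<And>e. satisfies A e \<Longrightarrow> satisfies C e" "carrier C = range r"
    "\<And>s t. r s = r t \<longleftrightarrow> (\<forall>\<^sub>F i in F. poly_eval A (d i) s = poly_eval A (d i) t)"
    "\<And>f s t. op_apply C f (r s) (r t) = r (App f s t)"
    "\<zero>\<^bsub>C\<^esub> = r (Cst \<zero>)" "\<one>\<^bsub>C\<^esub> = r (Cst \<one>)"
    using reduced_power_extension[OF residuated_lattice_axioms, of d F] d Ds_closed by blast
  note op = C(5)[of OMeet, simplified] C(5)[of OJoin, simplified]
    C(5)[of OMult, simplified] C(5)[of OImp, simplified]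
  have CV: "C \<in> V" using C AV by (auto simp: E)
  \<comment> \<open>The diagonal embedding. It is injective because the filter is proper: distinct
    constants cannot agree eventually.\<close>
  define \<iota> where "\<iota> = (\<lambda>a. r (Cst a))"
  have \<iota>: "\<iota> \<in> rl_hom A C"
    unfolding rl_hom_def \<iota>_def
    by (auto simp: C(3,4,6,7) op meet_closed join_closed imp_closed)
  have "inj_on \<iota> (carrier A)"
    using F by (auto simp: inj_on_def \<iota>_def C(4))
  moreover have "(\<lambda>x. x) \<in> rl_hom A A"
    by (simp add: rl_hom_def)
  ultimately obtain h where h: "h \<in> rl_hom C A" and h\<iota>: "\<And>x. x \<in> carrier A \<Longrightarrow> h (\<iota> x) = x"
    using injective_extend[OF inj AV CV \<iota>] by metis
  \<comment> \<open>The polynomial for the negation of \<open>X\<close> evaluates to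
    \<open>\<zero>\<close> at every index, since every \<open>d i\<close> is dense.\<close>
  have "r X \<in> Ds C"
    using d[THEN Ds_imp_zero] by (simp add: Ds_def rl_neg_def C(3,4,6) op zero_closed rangeI)
  then have "h (r X) \<in> Ds A"
    using rl_hom_Ds[OF C(1) h] by blast
  moreover have "h (r X) \<preceq> x" if x: "x \<in> Ds A" for x
  proof -
    have "r X \<preceq>\<^bsub>C\<^esub> \<iota> x"
      using below[OF x] Ds_closed[OF x] by (simp add: \<iota>_def rl_le_def op C(4))
    then have "h (r X) \<preceq> h (\<iota> x)"
      using rl_hom_le[OF h] C(3) by (simp add: \<iota>_def)
    then show ?thesis by (simp add: h\<iota> Ds_closed x)
  qed
  ultimately show ?thesis by blast
qed


subsection \<open>Extending homomorphisms from three-element chains\<close>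

text \<open>The operation tables of the elements 0, \<open>e\<close>, 1 are forced by density and
  idempotence of \<open>e\<close>, and 0, \<open>m\<close>, 1 obey the same tables in
  \<open>A\<close>. Only the inclusion into \<open>T\<close> has to be injective, so
  \<open>m\<close> may well be \<open>\<one>\<close>.\<close>

lemma injective_extend_idempotent:
  fixes V :: "'u::infinite rl set"
  assumes V: "rl_variety V" and inj: "injective_in V A" and T: "T \<in> V"
    and e: "e \<in> Ds T" "idempotent T e" "e \<noteq> \<one>\<^bsub>T\<^esub>"
    and m: "m \<in> Ds A" "idempotent A m"
  shows "\<exists>h\<in>rl_hom T A. h e = m"
proof -
  obtain E where E: "V = {A. residuated_lattice A \<and> (\<forall>e\<in>E. satisfies A e)}"
    using V by (auto simp: rl_variety_def)
  interpret A: residuated_lattice A using inj E by (simp add: injective_in_def)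
  interpret T: residuated_lattice T using T E by simp
  have ec: "e \<in> carrier T" and mc: "m \<in> carrier A"
    using e m by (simp_all add: T.Ds_closed A.Ds_closed)
  \<comment> \<open>These laws, applied to 0, to 1 and to the middle element, fix every table entry
    except the square and the negation of the middle element. They are stated for any
    \<open>B\<close> so as to serve both \<open>T\<close> and \<open>A\<close>.\<close>
  have tables: "x \<curlywedge>\<^bsub>B\<^esub> x = x" "x \<curlyvee>\<^bsub>B\<^esub> x = x" "(x \<Rrightarrow>\<^bsub>B\<^esub> x) = \<one>\<^bsub>B\<^esub>"
    "\<zero>\<^bsub>B\<^esub> \<curlywedge>\<^bsub>B\<^esub> x = \<zero>\<^bsub>B\<^esub>" "x \<curlywedge>\<^bsub>B\<^esub> \<zero>\<^bsub>B\<^esub> = \<zero>\<^bsub>B\<^esub>" "\<one>\<^bsub>B\<^esub> \<curlywedge>\<^bsub>B\<^esub> x = x" "x \<curlywedge>\<^bsub>B\<^esub> \<one>\<^bsub>B\<^esub> = x"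
    "\<zero>\<^bsub>B\<^esub> \<curlyvee>\<^bsub>B\<^esub> x = x" "x \<curlyvee>\<^bsub>B\<^esub> \<zero>\<^bsub>B\<^esub> = x" "\<one>\<^bsub>B\<^esub> \<curlyvee>\<^bsub>B\<^esub> x = \<one>\<^bsub>B\<^esub>" "x \<curlyvee>\<^bsub>B\<^esub> \<one>\<^bsub>B\<^esub> = \<one>\<^bsub>B\<^esub>"
    "\<zero>\<^bsub>B\<^esub> \<otimes>\<^bsub>B\<^esub> x = \<zero>\<^bsub>B\<^esub>" "x \<otimes>\<^bsub>B\<^esub> \<zero>\<^bsub>B\<^esub> = \<zero>\<^bsub>B\<^esub>" "\<one>\<^bsub>B\<^esub> \<otimes>\<^bsub>B\<^esub> x = x" "x \<otimes>\<^bsub>B\<^esub> \<one>\<^bsub>B\<^esub> = x"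
    "(\<zero>\<^bsub>B\<^esub> \<Rrightarrow>\<^bsub>B\<^esub> x) = \<one>\<^bsub>B\<^esub>" "(x \<Rrightarrow>\<^bsub>B\<^esub> \<one>\<^bsub>B\<^esub>) = \<one>\<^bsub>B\<^esub>" "(\<one>\<^bsub>B\<^esub> \<Rrightarrow>\<^bsub>B\<^esub> x) = x"
    if B: "residuated_lattice B" and x: "x \<in> carrier B" for B :: "'u rl" and x
  proof -
    interpret B: residuated_lattice B by fact
    note z = B.zero_least[OF x] B.one_greatest[OF x] B.zero_closed B.one_closed
      B.meet_comm[OF x B.zero_closed] B.meet_comm[OF x B.one_closed] B.m_comm[OF x B.zero_closed, symmetric]
      B.join_comm[OF x B.zero_closed, symmetric] B.join_comm[OF x B.one_closed, symmetric]
    show "x \<curlywedge>\<^bsub>B\<^esub> x = x" "x \<curlyvee>\<^bsub>B\<^esub> x = x" "(x \<Rrightarrow>\<^bsub>B\<^esub> x) = \<one>\<^bsub>B\<^esub>"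
      "\<zero>\<^bsub>B\<^esub> \<curlywedge>\<^bsub>B\<^esub> x = \<zero>\<^bsub>B\<^esub>" "x \<curlywedge>\<^bsub>B\<^esub> \<zero>\<^bsub>B\<^esub> = \<zero>\<^bsub>B\<^esub>" "\<one>\<^bsub>B\<^esub> \<curlywedge>\<^bsub>B\<^esub> x = x" "x \<curlywedge>\<^bsub>B\<^esub> \<one>\<^bsub>B\<^esub> = x"
      "\<zero>\<^bsub>B\<^esub> \<curlyvee>\<^bsub>B\<^esub> x = x" "x \<curlyvee>\<^bsub>B\<^esub> \<zero>\<^bsub>B\<^esub> = x" "\<one>\<^bsub>B\<^esub> \<curlyvee>\<^bsub>B\<^esub> x = \<one>\<^bsub>B\<^esub>" "x \<curlyvee>\<^bsub>B\<^esub> \<one>\<^bsub>B\<^esub> = \<one>\<^bsub>B\<^esub>"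
      "\<zero>\<^bsub>B\<^esub> \<otimes>\<^bsub>B\<^esub> x = \<zero>\<^bsub>B\<^esub>" "x \<otimes>\<^bsub>B\<^esub> \<zero>\<^bsub>B\<^esub> = \<zero>\<^bsub>B\<^esub>" "\<one>\<^bsub>B\<^esub> \<otimes>\<^bsub>B\<^esub> x = x" "x \<otimes>\<^bsub>B\<^esub> \<one>\<^bsub>B\<^esub> = x"
      "(\<zero>\<^bsub>B\<^esub> \<Rrightarrow>\<^bsub>B\<^esub> x) = \<one>\<^bsub>B\<^esub>" "(x \<Rrightarrow>\<^bsub>B\<^esub> \<one>\<^bsub>B\<^esub>) = \<one>\<^bsub>B\<^esub>" "(\<one>\<^bsub>B\<^esub> \<Rrightarrow>\<^bsub>B\<^esub> x) = x"
      using x z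
      by (simp_all add: B.meet_idem B.join_idem B.imp_eq_one_iff B.le_refl B.join_zero B.join_one
          B.mult_zero B.one_imp rl_le_def)
  qed
  note tabT = tables[OF T.residuated_lattice_axioms ec] tables[OF T.residuated_lattice_axioms T.zero_closed]
    tables[OF T.residuated_lattice_axioms T.one_closed] T.Ds_imp_zero[OF e(1)] e(2)[unfolded idempotent_def]
  note tabA = tables[OF A.residuated_lattice_axioms mc] tables[OF A.residuated_lattice_axioms A.zero_closed]
    tables[OF A.residuated_lattice_axioms A.one_closed] A.Ds_imp_zero[OF m(1)] m(2)[unfolded idempotent_def]
  define S where "S = {\<zero>\<^bsub>T\<^esub>, e, \<one>\<^bsub>T\<^esub>}"
  have ST: "S \<subseteq> carrier T"
    by (simp add: S_def ec T.zero_closed)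
  have SV: "T\<lparr>carrier := S\<rparr> \<in> V"
  proof -
    have "residuated_lattice (T\<lparr>carrier := S\<rparr>)"
      by (rule T.subalgebra[OF ST]) (auto simp: S_def tabT)
    then show ?thesis
      using T satisfies_subalgebra[OF _ ST] by (simp add: E)
  qed
  \<comment> \<open>If \<open>e\<close> were 0, its negation would be 1 as well as 0, so
    \<open>e\<close> would be 1. If 0 and 1 coincided, \<open>T\<close> would collapse and again
    \<open>e\<close> would be 1. Hence \<open>g\<close> below is determined by its three
    cases.\<close>
  have "\<zero>\<^bsub>T\<^esub> \<noteq> e"
    using e tabT by auto
  moreover have "\<zero>\<^bsub>T\<^esub> \<noteq> \<one>\<^bsub>T\<^esub>"
    using e(3) tabT by metis
  ultimately have distinct: "\<zero>\<^bsub>T\<^esub> \<noteq> e" "e \<noteq> \<zero>\<^bsub>T\<^esub>" "\<zero>\<^bsub>T\<^esub> \<noteq> \<one>\<^bsub>T\<^esub>" "\<one>\<^bsub>T\<^esub> \<noteq> \<zero>\<^bsub>T\<^esub>" "\<one>\<^bsub>T\<^esub> \<noteq> e" "e \<noteq> \<one>\<^bsub>T\<^esub>"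
    using e(3) by auto
  define g where "g = (\<lambda>x. if x = \<zero>\<^bsub>T\<^esub> then \<zero>\<^bsub>A\<^esub> else if x = e then m else \<one>\<^bsub>A\<^esub>)"
  have g: "g \<zero>\<^bsub>T\<^esub> = \<zero>\<^bsub>A\<^esub>" "g e = m" "g \<one>\<^bsub>T\<^esub> = \<one>\<^bsub>A\<^esub>"
    using distinct by (simp_all add: g_def)
  have "g \<in> rl_hom (T\<lparr>carrier := S\<rparr>) A"
    by (auto simp: rl_hom_def S_def g tabT tabA mc A.zero_closed)
  moreover have "(\<lambda>x. x) \<in> rl_hom (T\<lparr>carrier := S\<rparr>) T"
    using ST by (auto simp: rl_hom_def)
  ultimately obtain h where "h \<in> rl_hom T A" "\<And>x. x \<in> S \<Longrightarrow> h x = g x"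
    using injective_extend[OF inj SV T, of "\<lambda>x. x" g] by (auto simp: inj_on_def)
  then show ?thesis
    using g by (auto simp: S_def)
qed

section \<open>Semisimplicity of the injective algebras\<close>

theorem theorem4p11:
  fixes V :: "'u::infinite rl set"
  assumes "radical_dense_variety V"
    and "\<exists>I. injective_in V I \<and> nontrivial I"
    and "\<exists>T\<in>V. test_d_algebra T"
  shows "\<forall>A. injective_in V A \<longrightarrow> semisimple A"
proof (intro allI impI)
  fix A assume inj: "injective_in V A"
  have V: "rl_variety V" and RD: "\<And>B. B \<in> V \<Longrightarrow> Rad B = Ds B"
    using assms(1) by (auto simp: radical_dense_variety_def)
  have AV: "A \<in> V" using inj by (simp add: injective_in_def)
  \<comment> \<open>Radical-density turns membership in \<open>Rad T\<close> into density, which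
    homomorphisms preserve.\<close>
  obtain T \<epsilon> t where T: "T \<in> V" and \<epsilon>: "\<epsilon> \<in> Ds T" "idempotent T \<epsilon>" "\<epsilon> \<noteq> \<one>\<^bsub>T\<^esub>"
    and t: "t \<in> Ds T" "t \<preceq>\<^bsub>T\<^esub> \<epsilon>" "(\<epsilon> \<Rrightarrow>\<^bsub>T\<^esub> t) \<preceq>\<^bsub>T\<^esub> \<epsilon>"
    using assms(3) RD unfolding test_d_algebra_def by metis
  interpret A: residuated_lattice A using AV V by (auto simp: rl_variety_def)
  interpret T: residuated_lattice T using T V by (auto simp: rl_variety_def)
  obtain m where m: "m \<in> Ds A" and least: "\<And>x. x \<in> Ds A \<Longrightarrow> m \<preceq>\<^bsub>A\<^esub> x"
    using injective_least_dense[OF V inj] by blast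
  have mc: "m \<in> carrier A" using m by (rule A.Ds_closed)
  \<comment> \<open>The square of \<open>m\<close> is dense and lies below \<open>m\<close>, so it
    equals \<open>m\<close> by minimality.\<close>
  have "idempotent A m"
    unfolding idempotent_def
    using A.le_antisym A.mult_le_left least A.mult_in_Ds m mc by simp
  then obtain h where h: "h \<in> rl_hom T A" "h \<epsilon> = m"
    using injective_extend_idempotent[OF V inj T \<epsilon> m] by blast
  have c: "\<epsilon> \<in> carrier T" "t \<in> carrier T"
    using \<epsilon> t by (simp_all add: T.Ds_closed)
  have ht: "h t \<in> Ds A"
    using rl_hom_Ds[OF T.residuated_lattice_axioms h(1) t(1)] .
  \<comment> \<open>Monotonicity puts \<open>h t\<close> below \<open>m\<close>, and density of
    \<open>h t\<close> puts it above.\<close>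
  have "h t = m"
    using A.le_antisym[OF A.Ds_closed[OF ht] mc] least[OF ht] rl_hom_le[OF h(1) c(2,1) t(2)] h(2)
    by simp
  then have "(m \<Rrightarrow>\<^bsub>A\<^esub> m) \<preceq>\<^bsub>A\<^esub> m"
    using rl_hom_le[OF h(1) T.imp_closed[OF c] c(1) t(3)] rl_homD(3)[OF h(1) c] h(2) by simp
  moreover have "(m \<Rrightarrow>\<^bsub>A\<^esub> m) = \<one>\<^bsub>A\<^esub>"
    using mc by (simp add: A.imp_eq_one_iff A.le_refl)
  ultimately have "m = \<one>\<^bsub>A\<^esub>"
    using mc by (simp add: A.one_le_iff)
  then have "Ds A = {\<one>\<^bsub>A\<^esub>}"
    using least A.one_in_Ds A.one_le_iff A.Ds_closed by blast
  then show "semisimple A"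
    by (simp add: semisimple_def RD AV)
qed

end
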